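(* Let $a>b>0$, $c^2=a^2-b^2$, let $\mathcal{E}$ be the ellipse $x^2/a^2+y^2/b^2=1$, and let $C=[x_c,y_c]$ be a point interior to $\mathcal{E}$. Let $\mathcal{T}_\circ$ be the Poncelet family of triangles inscribed in $\mathcal{E}$ and circumscribing a circle centered at $C$. Then the locus $\mathcal{L}_2$ of the barycenter $X_2$ over $\mathcal{T}_\circ$ is an ellipse homothetic to $\mathcal{E}$. Its center $C_2$ is collinear with the center of $\mathcal{E}$ and $C$. The center $C_2$ and the semi-axis lengths $a_2,b_2$ (along the $x$- and $y$-directions) are given by \[ C_2=\tfrac23[x_c,y_c],\qquad a_2^2=\frac{-4ab(a^2+b^2)\delta-4b^4c^2x_c^2+4a^4c^2y_c^2+a^2b^2(a^4+6a^2b^2+b^4)}{9b^2c^4},\qquad b_2^2=\frac{b^2}{a^2}a_2^2, \] where $\delta=\sqrt{(b^4+c^2y_c^2)(a^4-c^2x_c^2)}$.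
   Context: For each point $C=[x_c,y_c]$ interior to $\mathcal{E}$ there is exactly one circle $\mathcal{K}$ centered at $C$, nested in $\mathcal{E}$, admitting triangles inscribed in $\mathcal{E}$ with all sides tangent to $\mathcal{K}$; its radius is $r=\big(b\sqrt{a^4-c^2x_c^2}-a\sqrt{b^4+c^2y_c^2}\big)/c^2$. By Poncelet's porism every point of $\mathcal{E}$ is then a vertex of exactly one such triangle. $\mathcal{T}_\circ$ is the family of all these triangles; $\mathcal{K}$ is their common incircle. The locus $\mathcal{L}_k$ of a triangle center $X_k$ is the set of positions of $X_k(T)$ as $T$ ranges over $\mathcal{T}_\circ$. Convention: an ellipse with both semi-axes zero means a single point (degenerate case). *)

theory Defs
  imports "HOL-Analysis.Analysis"
begin

text \<open>The plane is \<^typ>\<open>real \<times> real\<close>, with its Euclidean metric.\<close>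

text \<open>Axis-parallel ellipse with centre \<open>q\<close> and semi-axes \<open>s\<close> (along x) and \<open>t\<close> (along y).
  By convention an ellipse both of whose semi-axes vanish is a single point.\<close>

definition ellipse :: "real \<times> real \<Rightarrow> real \<Rightarrow> real \<Rightarrow> (real \<times> real) set" where
  "ellipse q s t =
     (if s = 0 \<and> t = 0 then {q}
      else {p. (fst p - fst q)\<^sup>2 / s\<^sup>2 + (snd p - snd q)\<^sup>2 / t\<^sup>2 = 1})"

definition ellipse_interior :: "real \<times> real \<Rightarrow> real \<Rightarrow> real \<Rightarrow> (real \<times> real) set" where
  "ellipse_interior q s t = {p. (fst p - fst q)\<^sup>2 / s\<^sup>2 + (snd p - snd q)\<^sup>2 / t\<^sup>2 < 1}"

text \<open>For \<open>P \<noteq> Q\<close> and \<open>0 < r\<close>: the line through \<open>P\<close> and \<open>Q\<close> meets the circle in exactly one point.\<close>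

definition line_tangent_to_circle ::
    "real \<times> real \<Rightarrow> real \<times> real \<Rightarrow> real \<times> real \<Rightarrow> real \<Rightarrow> bool" where
  "line_tangent_to_circle P Q C r \<longleftrightarrow> (\<exists>!X. X \<in> affine hull {P, Q} \<and> X \<in> sphere C r)"

text \<open>Nondegenerate triangles (as ordered triples of vertices) inscribed in the ellipse and
  circumscribing a circle centred at \<open>C\<close> that is nested in the ellipse. Nestedness forces each side,
  being a chord, to touch the circle between its end points, so the circle is the incircle.
  The radius is determined by the ellipse and \<open>C\<close>, so quantifying over it inside the
  definition yields one Poncelet family.\<close>

definition poncelet_family ::
    "real \<Rightarrow> real \<Rightarrow> real \<times> real \<Rightarrow> ((real \<times> real) \<times> (real \<times> real) \<times> (real \<times> real)) set" where
  "poncelet_family a b C =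
     {(P, Q, R). \<not> collinear {P, Q, R} \<and> {P, Q, R} \<subseteq> ellipse (0, 0) a b \<and>
        (\<exists>r>0. cball C r \<subseteq> ellipse_interior (0, 0) a b \<and>
           line_tangent_to_circle P Q C r \<and>
           line_tangent_to_circle Q R C r \<and>
           line_tangent_to_circle R P C r)}"

definition barycenter :: "real \<times> real \<Rightarrow> real \<times> real \<Rightarrow> real \<times> real \<Rightarrow> real \<times> real" where
  "barycenter P Q R = (1 / 3) *\<^sub>R (P + Q + R)"

definition barycenter_locus :: "real \<Rightarrow> real \<Rightarrow> real \<times> real \<Rightarrow> (real \<times> real) set" where
  "barycenter_locus a b C = {barycenter P Q R | P Q R. (P, Q, R) \<in> poncelet_family a b C}"

definition homothety :: "real \<times> real \<Rightarrow> real \<Rightarrow> real \<times> real \<Rightarrow> real \<times> real" where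
  "homothety Q k p = Q + k *\<^sub>R (p - Q)"

definition homothetic :: "(real \<times> real) set \<Rightarrow> (real \<times> real) set \<Rightarrow> bool" where
  "homothetic S T \<longleftrightarrow> (\<exists>Q k. k \<noteq> 0 \<and> S = homothety Q k ` T)"

end

theory Submission
  imports Defs "HOL-Computational_Algebra.Fundamental_Theorem_Algebra"
begin

text \<open>The affine map \<open>stretch a b\<close> takes the unit circle of the complex plane to \<open>\<E>\<close>; its inverse
  takes the circle \<open>\<K>\<close> to an ellipse with foci \<open>f\<close>, \<open>g\<close>. For unit \<open>z\<close>, \<open>w\<close> tangency of the chord \<open>zw\<close> is a symmetric
  polynomial condition, and a triple satisfies it pairwise iff the vertices are the roots of
  \<open>z (z - f) (z - g) = \<mu> (1 - cnj f z) (1 - cnj g z)\<close> with \<open>\<mu> = z1 z2 z3\<close> and the radius fulfils a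
  closure condition. Comparing coefficients, \<open>z1 + z2 + z3 = f + g + \<mu> cnj (f g)\<close>, so the barycenters
  run through a circle around \<open>(f + g) / 3\<close> of radius \<open>\<bar>f g\<bar> / 3\<close>. Every unit \<open>\<mu>\<close> occurs, because a
  Blaschke product of degree 3 takes unit values only on the unit circle.\<close>

section \<open>Tangent chords and the symmetric functions of their end points\<close>

text \<open>A symmetric form of degree 2 in each of \<open>z\<close> and \<open>w\<close>: the
  tangency condition for the line through two unit numbers and the preimage of the circle under
  \<open>stretch\<close>, an ellipse with centre \<open>m\<close> and with \<open>q\<close> as the
  product of its foci. The parameters are left free, so that the algebra of triples does not involve
  \<open>a\<close>, \<open>b\<close> and the radius.\<close>

definition chord_form :: "complex \<Rightarrow> complex \<Rightarrow> real \<Rightarrow> complex \<Rightarrow> complex \<Rightarrow> complex" where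
  "chord_form m q \<kappa> z w = q + cnj q * (z * w)\<^sup>2 + (z + w)\<^sup>2 - 2 * m * (z + w)
     - 2 * cnj m * (z * w) * (z + w) + 2 * of_real \<kappa> * (z * w)"

lemma cnj_mult_self_unit: "cmod z = 1 \<Longrightarrow> z * cnj z = 1"
  by (metis complex_norm_square of_real_1 one_power2)

text \<open>Two chords share each vertex. The difference of their equations, divided by the
  difference of the other end points, is an affine condition on that vertex whose coefficients are
  symmetric in the triple. It holds at distinct vertices, so both coefficients vanish. One is the
  formula for the sum; the other becomes the closure condition because conjugation inverts unit
  numbers.\<close>

lemma chord_form_triple:
  assumes unit: "cmod z1 = 1" "cmod z2 = 1" "cmod z3 = 1"
    and distinct: "z1 \<noteq> z2" "z1 \<noteq> z3" "z2 \<noteq> z3"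
    and chords: "chord_form m q \<kappa> z1 z2 = 0" "chord_form m q \<kappa> z2 z3 = 0" "chord_form m q \<kappa> z3 z1 = 0"
  shows "z1 + z2 + z3 = 2 * m + cnj q * (z1 * z2 * z3)"
    and "1 + (cmod q)\<^sup>2 + 2 * \<kappa> = 4 * (cmod m)\<^sup>2"
proof -
  define e1 e2 e3 where "e1 = z1 + z2 + z3" and "e2 = z1 * z2 + z2 * z3 + z3 * z1"
    and "e3 = z1 * z2 * z3"
  \<comment> \<open>\<open>D x y z\<close> is the divided difference of
    \<open>chord_form m q \<kappa> x\<close> at \<open>y\<close> and \<open>z\<close>.\<close>
  define D where "D x y z = (cnj q * x\<^sup>2 - 2 * cnj m * x + 1) * (y + z)
      + (2 * x - 2 * m - 2 * cnj m * x\<^sup>2 + 2 * of_real \<kappa> * x)" for x y z :: complex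
  have sub: "chord_form m q \<kappa> x y - chord_form m q \<kappa> z x = (y - z) * D x y z" for x y z
    by (simp add: chord_form_def D_def algebra_simps power2_eq_square)
  have D1: "D z1 z2 z3 = 0" using sub[of z1 z2 z3] chords distinct by simp
  have D2: "D z2 z3 z1 = 0" using sub[of z2 z3 z1] chords distinct by simp
  have "(z1 - z2) * (cnj q * e2 - 2 * cnj m * e1 + 1 + 2 * of_real \<kappa>) = D z1 z2 z3 - D z2 z3 z1"
    by (simp add: D_def e1_def e2_def algebra_simps power2_eq_square)
  hence top: "cnj q * e2 - 2 * cnj m * e1 + 1 + 2 * of_real \<kappa> = 0"
    using D1 D2 distinct by simp
  have "D z1 z2 z3 = e1 - 2 * m - cnj q * e3
      + z1 * (cnj q * e2 - 2 * cnj m * e1 + 1 + 2 * of_real \<kappa>)"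
    by (simp add: D_def e1_def e2_def e3_def algebra_simps power2_eq_square)
  hence e1: "e1 = 2 * m + cnj q * e3" using D1 top by (simp add: diff_eq_eq add.commute)
  thus "z1 + z2 + z3 = 2 * m + cnj q * (z1 * z2 * z3)" by (simp add: e1_def e3_def)
  have u: "z1 * cnj z1 = 1" "z2 * cnj z2 = 1" "z3 * cnj z3 = 1"
    using unit by (simp_all add: cnj_mult_self_unit)
  have e2: "e2 = e3 * cnj e1"
  proof -
    have "e3 * cnj e1 = (z1 * cnj z1) * (z2 * z3) + (z2 * cnj z2) * (z3 * z1) + (z3 * cnj z3) * (z1 * z2)"
      by (simp add: e1_def e3_def algebra_simps)
    thus ?thesis unfolding u by (simp add: e2_def algebra_simps)
  qed
  have e33: "e3 * cnj e3 = 1"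
    unfolding e3_def using unit by (intro cnj_mult_self_unit) (simp add: norm_mult)
  have "e2 = 2 * cnj m * e3 + q * (e3 * cnj e3)"
    using e2 arg_cong[OF e1, of cnj] by (simp add: algebra_simps)
  hence e2': "e2 = 2 * cnj m * e3 + q" using e33 by simp
  \<comment> \<open>Every term with \<open>e3\<close> cancels: what is left no longer depends on the
    triangle.\<close>
  have "1 + q * cnj q + 2 * of_real \<kappa> = 4 * (m * cnj m)"
    using top unfolding e1 e2' by (simp add: algebra_simps)
  hence "complex_of_real (1 + (cmod q)\<^sup>2 + 2 * \<kappa>) = of_real (4 * (cmod m)\<^sup>2)"
    by (simp only: of_real_add of_real_mult of_real_1 of_real_numeral complex_norm_square)
  thus "1 + (cmod q)\<^sup>2 + 2 * \<kappa> = 4 * (cmod m)\<^sup>2" using of_real_eq_iff by blast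
qed

text \<open>The two relations are linear equations for \<open>z3\<close> in terms of
  \<open>z1 + z2\<close> and \<open>z1 * z2\<close>. Eliminating \<open>z3\<close> leaves
  \<open>chord_form\<close>, with its coefficient \<open>\<kappa>\<close> supplied by the closure
  condition.\<close>

lemma chord_form_eq_0_if_symmetric:
  assumes "z3 \<noteq> 0" and e1: "z1 + z2 + z3 = 2 * m + cnj q * (z1 * z2 * z3)"
    and e2: "z1 * z2 + z2 * z3 + z3 * z1 = q + 2 * cnj m * (z1 * z2 * z3)"
    and cayley: "1 + (cmod q)\<^sup>2 + 2 * \<kappa> = 4 * (cmod m)\<^sup>2"
  shows "chord_form m q \<kappa> z1 z2 = 0"
proof -
  have "complex_of_real (1 + (cmod q)\<^sup>2 + 2 * \<kappa>) = of_real (4 * (cmod m)\<^sup>2)"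
    using cayley by presburger
  hence k: "1 + q * cnj q + 2 * of_real \<kappa> = 4 * (m * cnj m)"
    by (simp only: of_real_add of_real_mult of_real_1 of_real_numeral complex_norm_square)
  hence k': "2 * of_real \<kappa> = 4 * (m * cnj m) - 1 - q * cnj q" by (simp add: algebra_simps)
  define s p where "s = z1 + z2" and "p = z1 * z2"
  have e1': "z3 * (1 - p * cnj q) = 2 * m - s" and e2': "z3 * (s - 2 * cnj m * p) = q - p"
    using e1 e2 by (simp_all add: s_def p_def algebra_simps)
  have "z3 * chord_form m q \<kappa> z1 z2
      = (q - p) * (z3 * (1 - p * cnj q)) - (2 * m - s) * (z3 * (s - 2 * cnj m * p))"
    unfolding chord_form_def k' s_def[symmetric] p_def[symmetric]
    by (simp add: algebra_simps power2_eq_square)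
  hence "z3 * chord_form m q \<kappa> z1 z2 = 0" unfolding e1' e2' by simp
  thus ?thesis using assms(1) by simp
qed

section \<open>Blaschke factors and cubic equations\<close>

text \<open>Compares the denominator of a Blaschke factor with its numerator. For
  \<open>cmod f < 1\<close> the sign depends only on the side of the unit circle on which
  \<open>z\<close> lies. No quotient is formed, since the denominator may vanish outside the
  disc.\<close>

lemma cmod_blaschke:
  "(cmod (1 - cnj f * z))\<^sup>2 - (cmod (z - f))\<^sup>2 = (1 - (cmod z)\<^sup>2) * (1 - (cmod f)\<^sup>2)"
  unfolding cmod_power2 by (simp add: power2_eq_square algebra_simps)

lemma blaschke_le:
  assumes "cmod f < 1" "1 \<le> cmod z"
  shows "cmod (1 - cnj f * z) \<le> cmod (z - f)"
proof (rule power2_le_imp_le)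
  have "(cmod f)\<^sup>2 \<le> 1" using assms(1) power_le_one[of "cmod f" 2] norm_ge_zero[of f] by linarith
  moreover have "1 \<le> (cmod z)\<^sup>2" using assms(2) by (rule one_le_power)
  ultimately have "(1 - (cmod z)\<^sup>2) * (1 - (cmod f)\<^sup>2) \<le> 0"
    by (intro mult_nonpos_nonneg) linarith+
  thus "(cmod (1 - cnj f * z))\<^sup>2 \<le> (cmod (z - f))\<^sup>2" using cmod_blaschke[of f z] by linarith
qed (rule norm_ge_zero)

lemma blaschke_less:
  assumes "cmod f < 1" "cmod z < 1"
  shows "cmod (z - f) < cmod (1 - cnj f * z)"
proof (rule power2_less_imp_less)
  have "(cmod f)\<^sup>2 < 1" "(cmod z)\<^sup>2 < 1"
    using assms by (simp_all only: abs_square_less_1 abs_norm_cancel)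
  hence "0 < (1 - (cmod z)\<^sup>2) * (1 - (cmod f)\<^sup>2)"
    by (intro mult_pos_pos) linarith+
  thus "(cmod (z - f))\<^sup>2 < (cmod (1 - cnj f * z))\<^sup>2" using cmod_blaschke[of f z] by linarith
qed (rule norm_ge_zero)

text \<open>The zeros of this Blaschke product are 0, \<open>f\<close> and \<open>g\<close>. Inside
  the disc the modulus of the left side is too small, outside it is too large; there the factor
  \<open>z\<close> alone gives strictness, so the weak comparison for \<open>f\<close> and
  \<open>g\<close> suffices.\<close>

lemma blaschke_root_unit:
  assumes f: "cmod f < 1" and g: "cmod g < 1" and l: "cmod \<mu> = 1"
    and root: "z * (z - f) * (z - g) = \<mu> * (1 - cnj f * z) * (1 - cnj g * z)"
  shows "cmod z = 1"
proof -
  have eq: "cmod z * (cmod (z - f) * cmod (z - g)) = cmod (1 - cnj f * z) * cmod (1 - cnj g * z)"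
    using arg_cong[OF root, of cmod] l by (simp add: norm_mult mult.assoc)
  show ?thesis
  proof (rule ccontr)
    assume "cmod z \<noteq> 1"
    then consider "cmod z < 1" | "cmod z > 1" by linarith
    then show False
    proof cases
      case 1
      have "cmod (z - f) * cmod (z - g) < cmod (1 - cnj f * z) * cmod (1 - cnj g * z)"
        using blaschke_less[OF f 1] blaschke_less[OF g 1] by (intro mult_strict_mono') auto
      moreover have "cmod z * (cmod (z - f) * cmod (z - g)) \<le> 1 * (cmod (z - f) * cmod (z - g))"
        using 1 by (intro mult_right_mono) auto
      ultimately show False using eq by simp
    next
      case 2
      have "z \<noteq> f" "z \<noteq> g" using 2 f g by auto
      hence "1 * (cmod (z - f) * cmod (z - g)) < cmod z * (cmod (z - f) * cmod (z - g))"
        using 2 by (intro mult_strict_right_mono) auto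
      moreover have "cmod (1 - cnj f * z) * cmod (1 - cnj g * z) \<le> cmod (z - f) * cmod (z - g)"
        using blaschke_le[OF f, of z] blaschke_le[OF g, of z] 2 by (intro mult_mono) auto
      ultimately show False using eq by simp
    qed
  qed
qed

text \<open>Vieta read backwards, to find vertices with given symmetric functions: the fundamental
  theorem of algebra yields one root, the quadratic formula the other two. Roots may coincide, so
  distinctness of the vertices takes a separate argument.\<close>

lemma monic_cubic_factors:
  fixes A B L :: complex
  obtains z1 z2 z3 where "z1 + z2 + z3 = A" "z1 * z2 + z2 * z3 + z3 * z1 = B" "z1 * z2 * z3 = L"
proof -
  have "\<not> constant (poly [:- L, B, - A, 1:])"
    by (simp add: constant_degree)
  then obtain z1 where "poly [:- L, B, - A, 1:] z1 = 0"
    using fundamental_theorem_of_algebra by blast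
  hence root: "z1 ^ 3 - A * z1\<^sup>2 + B * z1 = L"
    by (simp add: algebra_simps power2_eq_square power3_eq_cube add_eq_0_iff)
  define S P where "S = A - z1" and "P = B - z1 * S"
  define s where "s = csqrt (S\<^sup>2 - 4 * P)"
  define z2 z3 where "z2 = (S + s) / 2" and "z3 = (S - s) / 2"
  have s2: "s\<^sup>2 = S\<^sup>2 - 4 * P" by (simp add: s_def)
  have sum: "z2 + z3 = S" by (simp add: z2_def z3_def field_simps)
  have "z2 * z3 = (S\<^sup>2 - s\<^sup>2) / 4" by (simp add: z2_def z3_def field_simps power2_eq_square)
  hence prod: "z2 * z3 = P" using s2 by simp
  have zP: "z1 * P = L"
    unfolding root[symmetric] P_def S_def
    by (simp add: algebra_simps power2_eq_square power3_eq_cube)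
  have "z1 * S + P = B" by (simp add: P_def)
  hence "z1 * z2 + z2 * z3 + z3 * z1 = B"
    using sum prod by (metis add.assoc add.commute distrib_left mult.commute)
  moreover have "z1 + z2 + z3 = A" using sum by (simp add: S_def algebra_simps)
  moreover have "z1 * z2 * z3 = L" using prod zP by (simp add: mult.assoc)
  ultimately show ?thesis using that by blast
qed

text \<open>Excludes coinciding vertices. Divided by \<open>z^2\<close>, the form on the diagonal is
  \<open>|z - f|^2 |z - g|^2\<close> times the logarithmic derivative \<open>z B'(z) / B(z)\<close>
  of the Blaschke product, which is 1 plus the Poisson kernels of \<open>f\<close> and
  \<open>g\<close> and hence positive.\<close>

lemma chord_form_diag_nonzero:
  assumes f: "cmod f < 1" and g: "cmod g < 1" and z: "cmod z = 1"
    and m: "2 * m = f + g" and q: "q = f * g"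
    and cayley: "1 + (cmod q)\<^sup>2 + 2 * \<kappa> = 4 * (cmod m)\<^sup>2"
  shows "chord_form m q \<kappa> z z \<noteq> 0"
proof
  assume F: "chord_form m q \<kappa> z z = 0"
  let ?N = "\<lambda>w. (cmod w)\<^sup>2"
  have zz: "z * cnj z = 1" using z by (rule cnj_mult_self_unit)
  have "complex_of_real (1 + (cmod q)\<^sup>2 + 2 * \<kappa>) = of_real (4 * (cmod m)\<^sup>2)"
    using cayley by presburger
  hence k: "1 + q * cnj q + 2 * of_real \<kappa> = (2 * m) * (2 * cnj m)"
    by (simp only: of_real_add of_real_mult of_real_1 of_real_numeral complex_norm_square)
       (simp add: mult_ac)
  have cm: "2 * cnj m = cnj f + cnj g" using arg_cong[OF m, of cnj] by simp
  have cq: "cnj q = cnj f * cnj g" using q by simp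
  have k': "2 * of_real \<kappa> = (f + g) * (cnj f + cnj g) - 1 - (f * g) * (cnj f * cnj g)"
    using k unfolding m cm cq q by (simp add: algebra_simps)
  have N: "complex_of_real (?N (z - h)) = 1 + h * cnj h - h * cnj z - cnj h * z" for h
    unfolding complex_norm_square complex_cnj_diff by (simp add: algebra_simps zz)
  \<comment> \<open>The last summand on the right is 0, as \<open>z * cnj z = 1\<close>; with it the
    equation is a polynomial identity in \<open>z\<close> and \<open>cnj z\<close>.\<close>
  have "complex_of_real (?N (z - f) * ?N (z - g) + (1 - ?N f) * ?N (z - g) + (1 - ?N g) * ?N (z - f))
     = (f * g) * (cnj z)\<^sup>2 + (cnj f * cnj g) * z\<^sup>2 + 4 - (f + g) * cnj z * 2 - (cnj f + cnj g) * z * 2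
       + 2 * of_real \<kappa> + (f * cnj g + cnj f * g) * (z * cnj z - 1)"
    unfolding of_real_add of_real_mult of_real_diff of_real_1 N complex_norm_square[of f]
      complex_norm_square[of g] k' by (simp add: algebra_simps power2_eq_square)
  also have "\<dots> = q * (cnj z)\<^sup>2 + cnj q * z\<^sup>2 + 4 - 4 * m * cnj z - 4 * cnj m * z + 2 * of_real \<kappa>"
    unfolding m[symmetric] cm[symmetric] cq[symmetric] q[symmetric] zz by simp
  \<comment> \<open>Powers of \<open>z * cnj z = 1\<close> are inserted so that
    \<open>cnj z * cnj z\<close> can be factored out.\<close>
  also have "\<dots> = q * (cnj z)\<^sup>2 + cnj q * z\<^sup>2 * (z * cnj z)\<^sup>2 + 4 * (z * cnj z)\<^sup>2
      - 4 * m * cnj z * (z * cnj z) - 4 * cnj m * z * (z * cnj z)\<^sup>2 + 2 * of_real \<kappa> * (z * cnj z)\<^sup>2"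
    unfolding zz by simp
  also have "\<dots> = cnj z * cnj z * chord_form m q \<kappa> z z"
    unfolding chord_form_def by (simp add: algebra_simps power2_eq_square)
  finally have "?N (z - f) * ?N (z - g) + (1 - ?N f) * ?N (z - g) + (1 - ?N g) * ?N (z - f) = 0"
    using F of_real_eq_0_iff by (metis mult_zero_right)
  moreover have "z \<noteq> f" "z \<noteq> g" using f g z by auto
  hence "?N (z - f) * ?N (z - g) > 0" by simp
  moreover have "?N f < 1" "?N g < 1"
    using f g by (simp_all only: abs_square_less_1 abs_norm_cancel)
  hence "(1 - ?N f) * ?N (z - g) \<ge> 0" "(1 - ?N g) * ?N (z - f) \<ge> 0"
    by simp_all
  ultimately show False by linarith
qed

section \<open>Tangency to a circle and the affine map to the ellipse\<close>

definition stretch :: "real \<Rightarrow> real \<Rightarrow> complex \<Rightarrow> real \<times> real" where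
  "stretch a b z = (a * Re z, b * Im z)"

text \<open>Tangency means that the distance of \<open>C\<close> from the line is \<open>r\<close>:
  the bracket on the left is a cross product, whose absolute value is this distance times the length
  of \<open>PQ\<close>. Parametrizing the line gives a quadratic equation, which has a unique
  solution iff its discriminant is 0.\<close>

lemma line_tangent_to_circle_iff:
  fixes P Q C :: "real \<times> real"
  assumes "P \<noteq> Q" and r: "0 < r"
  shows "line_tangent_to_circle P Q C r \<longleftrightarrow>
    ((fst P - fst C) * (snd Q - snd P) - (snd P - snd C) * (fst Q - fst P))\<^sup>2
      = r\<^sup>2 * ((fst Q - fst P)\<^sup>2 + (snd Q - snd P)\<^sup>2)"
proof -
  define d1 d2 u1 u2 where "d1 = fst Q - fst P" and "d2 = snd Q - snd P"
    and "u1 = fst P - fst C" and "u2 = snd P - snd C"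
  define D E \<Delta> where "D = d1\<^sup>2 + d2\<^sup>2" and "E = u1 * d1 + u2 * d2"
    and "\<Delta> = E\<^sup>2 - D * (u1\<^sup>2 + u2\<^sup>2 - r\<^sup>2)"
  have "d1 \<noteq> 0 \<or> d2 \<noteq> 0" using \<open>P \<noteq> Q\<close> by (auto simp: d1_def d2_def prod_eq_iff)
  hence D: "D > 0" by (simp add: D_def sum_power2_gt_zero_iff)
  \<comment> \<open>Lagrange's identity for the squares of scalar and cross product.\<close>
  have disc: "\<Delta> = r\<^sup>2 * D - (u1 * d2 - u2 * d1)\<^sup>2"
    by (simp add: \<Delta>_def D_def E_def power2_eq_square algebra_simps)
  define X where "X t = P + t *\<^sub>R (Q - P)" for t :: real
  have hull: "affine hull {P, Q} = range X"
  proof -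
    have "affine hull {P, Q} = {u *\<^sub>R P + v *\<^sub>R Q |u v. u + v = 1}" by (rule affine_hull_2)
    also have "\<dots> = range X"
    proof (intro subset_antisym subsetI)
      fix Y assume "Y \<in> {u *\<^sub>R P + v *\<^sub>R Q |u v. u + v = 1}"
      then obtain u v where Y: "Y = u *\<^sub>R P + v *\<^sub>R Q" and "u + v = 1" by blast
      hence u: "u = 1 - v" by simp
      have "Y = X v" by (simp add: Y X_def u algebra_simps)
      thus "Y \<in> range X" by blast
    next
      fix Y assume "Y \<in> range X"
      then obtain t where "Y = X t" by blast
      hence "Y = (1 - t) *\<^sub>R P + t *\<^sub>R Q" by (simp add: X_def algebra_simps)
      thus "Y \<in> {u *\<^sub>R P + v *\<^sub>R Q |u v. u + v = 1}" by force
    qed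
    finally show ?thesis .
  qed
  have "inj X" using \<open>P \<noteq> Q\<close> by (auto simp: inj_def X_def)
  have sphere: "X t \<in> sphere C r \<longleftrightarrow> (D * t + E)\<^sup>2 = \<Delta>" for t
  proof -
    have "X t \<in> sphere C r \<longleftrightarrow> dist (X t) C = r" by (simp add: dist_commute)
    also have "\<dots> \<longleftrightarrow> (dist (X t) C)\<^sup>2 = r\<^sup>2"
      using r by (intro power2_eq_iff_nonneg[symmetric]) simp_all
    also have "(dist (X t) C)\<^sup>2 = (fst (X t) - fst C)\<^sup>2 + (snd (X t) - snd C)\<^sup>2"
      unfolding dist_prod_def dist_real_def power2_abs by (rule real_sqrt_pow2) simp
    also have "\<dots> = (u1 + t * d1)\<^sup>2 + (u2 + t * d2)\<^sup>2"
    proof -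
      have "fst (X t) - fst C = u1 + t * d1" by (simp add: X_def u1_def d1_def)
      moreover have "snd (X t) - snd C = u2 + t * d2" by (simp add: X_def u2_def d2_def)
      ultimately show ?thesis by (simp only:)
    qed
    also have "\<dots> = r\<^sup>2 \<longleftrightarrow> (D * t + E)\<^sup>2 = \<Delta>"
    proof -
      have "(D * t + E)\<^sup>2 - \<Delta> = D * ((u1 + t * d1)\<^sup>2 + (u2 + t * d2)\<^sup>2 - r\<^sup>2)"
        by (simp add: D_def E_def \<Delta>_def power2_eq_square algebra_simps)
      thus ?thesis using D by (metis eq_iff_diff_eq_0 mult_eq_0_iff less_irrefl)
    qed
    finally show ?thesis .
  qed
  have "line_tangent_to_circle P Q C r \<longleftrightarrow> (\<exists>!t. (D * t + E)\<^sup>2 = \<Delta>)"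
    unfolding line_tangent_to_circle_def hull sphere[symmetric]
  proof
    assume "\<exists>!Y. Y \<in> range X \<and> Y \<in> sphere C r"
    then obtain t where t: "X t \<in> sphere C r" and uniq: "\<And>s. X s \<in> sphere C r \<Longrightarrow> X s = X t"
      by blast
    thus "\<exists>!t. X t \<in> sphere C r" using injD[OF \<open>inj X\<close>] by blast
  next
    assume "\<exists>!t. X t \<in> sphere C r"
    thus "\<exists>!Y. Y \<in> range X \<and> Y \<in> sphere C r" by blast
  qed
  also have "\<dots> \<longleftrightarrow> \<Delta> = 0"
  proof
    assume "\<exists>!t. (D * t + E)\<^sup>2 = \<Delta>"
    then obtain t where t: "(D * t + E)\<^sup>2 = \<Delta>" and uniq: "\<And>s. (D * s + E)\<^sup>2 = \<Delta> \<Longrightarrow> s = t" by blast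
    \<comment> \<open>Solutions lie symmetrically about \<open>- E / D\<close>, so a unique one must
      be this point.\<close>
    have reflect: "D * (- t - 2 * E / D) + E = - (D * t + E)" using D by (simp add: field_simps)
    have "(D * (- t - 2 * E / D) + E)\<^sup>2 = \<Delta>" unfolding reflect power2_minus by (rule t)
    hence "- t - 2 * E / D = t" by (rule uniq)
    hence "D * t + E = 0" using D by (simp add: field_simps)
    thus "\<Delta> = 0" using t by simp
  next
    assume "\<Delta> = 0"
    moreover have "D * t + E = 0 \<longleftrightarrow> t = - E / D" for t using D by (auto simp: field_simps)
    ultimately show "\<exists>!t. (D * t + E)\<^sup>2 = \<Delta>" by simp
  qed
  also have "\<dots> \<longleftrightarrow> (u1 * d2 - u2 * d1)\<^sup>2 = r\<^sup>2 * D" unfolding disc by auto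
  finally show ?thesis by (simp add: D_def u1_def u2_def d1_def d2_def)
qed

text \<open>For unit \<open>z\<close>, \<open>w\<close> the conjugate of \<open>d = w - z\<close> is \<open>- d / (z * w)\<close>, so after multiplication by
  \<open>(z * w)\<^sup>2\<close> the tangency condition becomes polynomial, with the common factor \<open>d\<^sup>2\<close>.\<close>

lemma tangent_stretch_iff_chord_form:
  assumes ab: "0 < a" "0 < b" and r: "0 < r" and z: "cmod z = 1" and w: "cmod w = 1" and "z \<noteq> w"
    and q: "q = m\<^sup>2 + of_real (r\<^sup>2 * (1 / b\<^sup>2 - 1 / a\<^sup>2))"
    and \<kappa>: "\<kappa> = (cmod m)\<^sup>2 - r\<^sup>2 * (1 / b\<^sup>2 + 1 / a\<^sup>2)"
  shows "line_tangent_to_circle (stretch a b z) (stretch a b w) (stretch a b m) r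
    \<longleftrightarrow> chord_form m q \<kappa> z w = 0"
proof -
  \<comment> \<open>\<open>T\<close> is 0 exactly when the line through \<open>z\<close> and
    \<open>w\<close> passes through \<open>m\<close>; \<open>x\<close> is the cross product of the
    tangency criterion before stretching.\<close>
  define p d T where "p = z * w" and "d = w - z" and "T = m + p * cnj m - (z + w)"
  define x where "x = Re (z - m) * Im d - Im (z - m) * Re d"
  have "p \<noteq> 0" "d \<noteq> 0" using z w \<open>z \<noteq> w\<close> by (auto simp: p_def d_def)
  have zz: "z * cnj z = 1" and ww: "w * cnj w = 1" using z w by (simp_all add: cnj_mult_self_unit)
  have "cnj d * p = (w * cnj w) * z - (z * cnj z) * w"
    by (simp add: d_def p_def algebra_simps)
  hence cd: "cnj d * p = - d" unfolding zz ww by (simp add: d_def)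
  have Re: "of_real (2 * Re d) = d + cnj d" and Im: "of_real (2 * Im d) * \<i> = d - cnj d"
    by (simp_all add: complex_eq_iff)
  have Rep: "of_real (2 * Re d) * p = d * (p - 1)"
    unfolding Re distrib_right cd by (simp add: algebra_simps)
  have Imp: "of_real (2 * Im d) * \<i> * p = d * (p + 1)"
    unfolding Im left_diff_distrib cd by (simp add: algebra_simps)
  have "of_real (2 * x) * \<i> = cnj (z - m) * d - (z - m) * cnj d"
    by (simp add: complex_eq_iff x_def algebra_simps)
  hence "of_real (2 * x) * \<i> * p = (cnj (z - m) * d - (z - m) * cnj d) * p" by simp
  also have "\<dots> = cnj (z - m) * d * p - (z - m) * (cnj d * p)" by (simp add: algebra_simps)
  also have "\<dots> = d * (z * cnj z * w - p * cnj m + z - m)"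
    unfolding cd by (simp add: p_def algebra_simps)
  also have "\<dots> = - (d * T)" unfolding zz by (simp add: T_def algebra_simps)
  finally have xp: "of_real (2 * x) * \<i> * p = - (d * T)" .
  let ?a = "complex_of_real a" and ?b = "complex_of_real b" and ?r = "complex_of_real r"
  have i2: "(u * \<i> * p)\<^sup>2 = - (u\<^sup>2 * p\<^sup>2)" for u by (simp add: power_mult_distrib)
  have sq: "of_real ((2 * x)\<^sup>2) * p\<^sup>2 = - (d\<^sup>2 * T\<^sup>2)"
    "of_real ((2 * Im d)\<^sup>2) * p\<^sup>2 = - (d\<^sup>2 * (p + 1)\<^sup>2)"
    "of_real ((2 * Re d)\<^sup>2) * p\<^sup>2 = d\<^sup>2 * (p - 1)\<^sup>2"
    using arg_cong[OF xp, of "\<lambda>u. u\<^sup>2"] arg_cong[OF Imp, of "\<lambda>u. u\<^sup>2"] arg_cong[OF Rep, of "\<lambda>u. u\<^sup>2"]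
    unfolding i2 by (simp_all add: power_mult_distrib minus_equation_iff)
  have fneq: "stretch a b z \<noteq> stretch a b w"
    using ab \<open>z \<noteq> w\<close> by (auto simp: stretch_def complex_eq_iff)
  have "line_tangent_to_circle (stretch a b z) (stretch a b w) (stretch a b m) r
    \<longleftrightarrow> (a * b * x)\<^sup>2 = r\<^sup>2 * ((a * Re d)\<^sup>2 + (b * Im d)\<^sup>2)"
    using line_tangent_to_circle_iff[OF fneq r, of "stretch a b m"]
    by (simp add: stretch_def x_def d_def algebra_simps)
  also have "\<dots> \<longleftrightarrow> complex_of_real ((a * b * x)\<^sup>2 - r\<^sup>2 * ((a * Re d)\<^sup>2 + (b * Im d)\<^sup>2)) = 0"
    unfolding of_real_eq_0_iff by simp
  \<comment> \<open>The factor \<open>4 * p\<^sup>2\<close> lets the three squares of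
    \<open>sq\<close> be substituted.\<close>
  also have "\<dots> \<longleftrightarrow> complex_of_real ((a * b * x)\<^sup>2 - r\<^sup>2 * ((a * Re d)\<^sup>2 + (b * Im d)\<^sup>2)) * (4 * p\<^sup>2) = 0"
    using \<open>p \<noteq> 0\<close> by simp
  also have "complex_of_real ((a * b * x)\<^sup>2 - r\<^sup>2 * ((a * Re d)\<^sup>2 + (b * Im d)\<^sup>2)) * (4 * p\<^sup>2)
      = (?a * ?b)\<^sup>2 * (of_real ((2 * x)\<^sup>2) * p\<^sup>2) - ?r\<^sup>2 * (?a\<^sup>2 * (of_real ((2 * Re d)\<^sup>2) * p\<^sup>2)
         + ?b\<^sup>2 * (of_real ((2 * Im d)\<^sup>2) * p\<^sup>2))"
    by (simp add: power_mult_distrib algebra_simps)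
  also have "\<dots> = - (d\<^sup>2) * (?a\<^sup>2 * ?b\<^sup>2 * T\<^sup>2 + ?r\<^sup>2 * (?a\<^sup>2 * (p - 1)\<^sup>2 - ?b\<^sup>2 * (p + 1)\<^sup>2))"
    unfolding sq by (simp add: power_mult_distrib algebra_simps)
  also have "?a\<^sup>2 * ?b\<^sup>2 * T\<^sup>2 + ?r\<^sup>2 * (?a\<^sup>2 * (p - 1)\<^sup>2 - ?b\<^sup>2 * (p + 1)\<^sup>2)
      = ?a\<^sup>2 * ?b\<^sup>2 * chord_form m q \<kappa> z w"
  proof -
    define A B where "A = 1 / ?a\<^sup>2" and "B = 1 / ?b\<^sup>2"
    have A: "?a\<^sup>2 * A = 1" and B: "?b\<^sup>2 * B = 1" using ab by (simp_all add: A_def B_def)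
    have q': "q = m\<^sup>2 + ?r\<^sup>2 * (B - A)" and cq: "cnj q = (cnj m)\<^sup>2 + ?r\<^sup>2 * (B - A)"
      by (simp_all add: q A_def B_def)
    have "complex_of_real \<kappa> = of_real ((cmod m)\<^sup>2) - ?r\<^sup>2 * (B + A)" by (simp add: \<kappa> A_def B_def)
    hence k: "complex_of_real \<kappa> = m * cnj m - ?r\<^sup>2 * (B + A)" by (simp only: complex_norm_square)
    have F: "chord_form m q \<kappa> z w = T\<^sup>2 + ?r\<^sup>2 * (B * (p - 1)\<^sup>2 - A * (p + 1)\<^sup>2)"
      unfolding chord_form_def cq
      unfolding q' k T_def p_def[symmetric]
      by (simp add: algebra_simps power2_eq_square)
    have "?a\<^sup>2 * ?b\<^sup>2 * chord_form m q \<kappa> z w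
        = ?a\<^sup>2 * ?b\<^sup>2 * T\<^sup>2 + ?r\<^sup>2 * (?a\<^sup>2 * (?b\<^sup>2 * B) * (p - 1)\<^sup>2 - ?b\<^sup>2 * (?a\<^sup>2 * A) * (p + 1)\<^sup>2)"
      unfolding F by (simp add: algebra_simps)
    thus ?thesis unfolding A B by simp
  qed
  also have "- (d\<^sup>2) * (?a\<^sup>2 * ?b\<^sup>2 * chord_form m q \<kappa> z w) = 0 \<longleftrightarrow> chord_form m q \<kappa> z w = 0"
    using ab \<open>d \<noteq> 0\<close> by simp
  finally show ?thesis .
qed

section \<open>Ellipses as images of circles\<close>

text \<open>Radius 0 is included: the convention for vanishing semi-axes makes both sides one
  point.\<close>

lemma ellipse_eq_stretch_sphere:
  assumes "0 < a" "0 < b" "0 \<le> \<rho>"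
  shows "ellipse (stretch a b m) (a * \<rho>) (b * \<rho>) = stretch a b ` sphere m \<rho>"
proof (cases "\<rho> = 0")
  case True thus ?thesis by (simp add: ellipse_def)
next
  case False
  hence \<rho>: "\<rho> > 0" using assms by simp
  show ?thesis
  proof (intro subset_antisym subsetI)
    fix p assume "p \<in> ellipse (stretch a b m) (a * \<rho>) (b * \<rho>)"
    hence p: "(fst p - a * Re m)\<^sup>2 / (a * \<rho>)\<^sup>2 + (snd p - b * Im m)\<^sup>2 / (b * \<rho>)\<^sup>2 = 1"
      using assms \<rho> by (simp add: ellipse_def stretch_def)
    define z where "z = Complex (fst p / a) (snd p / b)"
    have pz: "p = stretch a b z" using assms by (simp add: z_def stretch_def)
    have "((Re z - Re m)\<^sup>2 + (Im z - Im m)\<^sup>2) / \<rho>\<^sup>2 = 1"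
      using p assms \<rho> unfolding pz stretch_def fst_conv snd_conv right_diff_distrib[symmetric] power_mult_distrib
      by (simp add: add_divide_distrib)
    hence "(cmod (z - m))\<^sup>2 = \<rho>\<^sup>2" using \<rho> by (simp add: cmod_power2)
    hence "cmod (z - m) = \<rho>" using \<rho> by (simp add: power2_eq_iff_nonneg)
    hence "z \<in> sphere m \<rho>" by (simp add: dist_norm norm_minus_commute)
    thus "p \<in> stretch a b ` sphere m \<rho>" using pz by blast
  next
    fix p assume "p \<in> stretch a b ` sphere m \<rho>"
    then obtain z where pz: "p = stretch a b z" and "cmod (z - m) = \<rho>"
      by (auto simp: dist_norm norm_minus_commute)
    hence "(Re z - Re m)\<^sup>2 + (Im z - Im m)\<^sup>2 = \<rho>\<^sup>2" using cmod_power2[of "z - m"] by simp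
    hence "((Re z - Re m)\<^sup>2 + (Im z - Im m)\<^sup>2) / \<rho>\<^sup>2 = 1" using \<rho> by simp
    hence "(fst p - a * Re m)\<^sup>2 / (a * \<rho>)\<^sup>2 + (snd p - b * Im m)\<^sup>2 / (b * \<rho>)\<^sup>2 = 1"
      using assms \<rho> unfolding pz stretch_def fst_conv snd_conv right_diff_distrib[symmetric] power_mult_distrib
      by (simp add: add_divide_distrib)
    thus "p \<in> ellipse (stretch a b m) (a * \<rho>) (b * \<rho>)"
      using assms \<rho> by (simp add: ellipse_def stretch_def)
  qed
qed

lemma stretch_in_interior_iff:
  assumes "0 < a" "0 < b"
  shows "stretch a b z \<in> ellipse_interior (0, 0) a b \<longleftrightarrow> cmod z < 1"
proof -
  have "stretch a b z \<in> ellipse_interior (0, 0) a b \<longleftrightarrow> (cmod z)\<^sup>2 < 1"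
    using assms by (simp add: ellipse_interior_def stretch_def cmod_power2 power_mult_distrib)
  thus ?thesis by (simp add: abs_square_less_1)
qed

text \<open>A line meets the unit circle at most twice: along the line through \<open>z1\<close> and
  \<open>z3\<close> the squared modulus differs from 1 by \<open>t (1 - t) |z1 - z3|^2\<close>,
  which vanishes only at these two points.\<close>

lemma not_collinear_stretch:
  assumes "0 < a" "0 < b" and unit: "cmod z1 = 1" "cmod z2 = 1" "cmod z3 = 1"
    and distinct: "z1 \<noteq> z2" "z1 \<noteq> z3" "z2 \<noteq> z3"
  shows "\<not> collinear {stretch a b z1, stretch a b z2, stretch a b z3}"
proof
  assume "collinear {stretch a b z1, stretch a b z2, stretch a b z3}"
  moreover have "stretch a b z1 \<noteq> stretch a b z3"
    using assms by (auto simp: stretch_def complex_eq_iff)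
  ultimately obtain t where t: "stretch a b z2 = t *\<^sub>R stretch a b z1 + (1 - t) *\<^sub>R stretch a b z3"
    by (auto simp: collinear_3_expand)
  have "z2 = of_real t * z1 + of_real (1 - t) * z3"
  proof (rule complex_eqI)
    have "a * Re z2 = a * (t * Re z1 + (1 - t) * Re z3)" "b * Im z2 = b * (t * Im z1 + (1 - t) * Im z3)"
      using t by (simp_all add: stretch_def algebra_simps)
    thus "Re z2 = Re (of_real t * z1 + of_real (1 - t) * z3)"
      "Im z2 = Im (of_real t * z1 + of_real (1 - t) * z3)" using assms(1,2) by simp_all
  qed
  hence z2: "Re z2 = t * Re z1 + (1 - t) * Re z3" "Im z2 = t * Im z1 + (1 - t) * Im z3" by simp_all
  have u: "(Re z1)\<^sup>2 + (Im z1)\<^sup>2 = 1" "(Re z2)\<^sup>2 + (Im z2)\<^sup>2 = 1" "(Re z3)\<^sup>2 + (Im z3)\<^sup>2 = 1"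
    using unit cmod_power2[of z1] cmod_power2[of z2] cmod_power2[of z3] by simp_all
  have "t * (1 - t) * ((Re z1 - Re z3)\<^sup>2 + (Im z1 - Im z3)\<^sup>2)
     = t * ((Re z1)\<^sup>2 + (Im z1)\<^sup>2) + (1 - t) * ((Re z3)\<^sup>2 + (Im z3)\<^sup>2) - ((Re z2)\<^sup>2 + (Im z2)\<^sup>2)"
    unfolding z2 by (simp add: power2_eq_square algebra_simps)
  hence "t * (1 - t) * ((Re z1 - Re z3)\<^sup>2 + (Im z1 - Im z3)\<^sup>2) = 0" unfolding u by simp
  moreover have "(Re z1 - Re z3)\<^sup>2 + (Im z1 - Im z3)\<^sup>2 \<noteq> 0"
    using distinct(2) by (auto simp: sum_power2_eq_zero_iff complex_eq_iff)
  ultimately have "t = 0 \<or> t = 1" by auto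
  thus False using z2 distinct by (auto simp: complex_eq_iff)
qed

section \<open>The preimage of the disc and its foci\<close>

text \<open>The preimage of the circle has semi-axes \<open>r / a\<close> and \<open>r / b\<close>;
  as \<open>b < a\<close>, its foci are \<open>m\<close> plus or minus
  \<open>\<i> * (r * c / (a * b))\<close>. Stretched, they have distance \<open>r |c| / a\<close>,
  at most \<open>r\<close>, from the centre and so lie in the nested disc. The absolute values cover
  both foci and either sign of \<open>c\<close>.\<close>

lemma norm_focus_less_1:
  assumes ab: "0 < b" "b < a" and c: "c\<^sup>2 = a\<^sup>2 - b\<^sup>2" and "0 < r"
    and nested: "cball (stretch a b m) r \<subseteq> ellipse_interior (0, 0) a b"
    and e: "\<bar>e\<bar> = \<bar>r * c / (a * b)\<bar>"
  shows "cmod (m + \<i> * of_real e) < 1"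
proof -
  have "\<bar>c\<bar> \<le> \<bar>a\<bar>" unfolding abs_le_square_iff using c by simp
  hence "r * \<bar>c\<bar> \<le> r * a" using ab \<open>0 < r\<close> by simp
  have "b * \<bar>e\<bar> = r * \<bar>c\<bar> / a" using ab \<open>0 < r\<close> unfolding e by (simp add: abs_mult field_simps)
  hence "a * (b * \<bar>e\<bar>) = r * \<bar>c\<bar>" using ab by simp
  with \<open>r * \<bar>c\<bar> \<le> r * a\<close> have "a * (b * \<bar>e\<bar>) \<le> a * r" by (simp add: mult.commute)
  hence "b * \<bar>e\<bar> \<le> r" using ab by simp
  hence "dist (stretch a b m) (stretch a b (m + \<i> * of_real e)) \<le> r"
    using ab by (simp add: stretch_def dist_prod_def dist_real_def real_sqrt_mult algebra_simps)
  hence "stretch a b (m + \<i> * of_real e) \<in> ellipse_interior (0, 0) a b" using nested by auto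
  thus ?thesis using ab by (simp add: stretch_in_interior_iff)
qed

text \<open>The disc becomes the filled ellipse \<open>\<bar>z - f\<bar> + \<bar>z - g\<bar> \<le> \<bar>1 - cnj f g\<bar>\<close>. Outside the open unit disc
  \<open>\<bar>1 - cnj f z\<bar> \<le> \<bar>z - f\<bar>\<close>, which makes the focal sum too large.\<close>

lemma cball_nested:
  assumes ab: "0 < b" "b < a" and c: "c\<^sup>2 = a\<^sup>2 - b\<^sup>2" and r: "0 < r" and e: "e = r * c / (a * b)"
    and f: "f = m + \<i> * of_real e" and g: "g = m - \<i> * of_real e"
    and "cmod f < 1" "cmod g < 1" and fg: "cmod (1 - cnj f * g) = 2 * r / b"
  shows "cball (stretch a b m) r \<subseteq> ellipse_interior (0, 0) a b"
proof
  fix P assume P: "P \<in> cball (stretch a b m) r"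
  define X Y where "X = fst P - a * Re m" and "Y = snd P - b * Im m"
  define z where "z = Complex (fst P / a) (snd P / b)"
  have Pz: "P = stretch a b z" using ab by (simp add: z_def stretch_def)
  have zm: "Re z = Re m + X / a" "Im z = Im m + Y / b"
    using ab by (simp_all add: z_def X_def Y_def field_simps)
  have "dist P (stretch a b m) \<le> r" using P by (simp add: dist_commute)
  hence "sqrt (X\<^sup>2 + Y\<^sup>2) \<le> r"
    by (simp add: dist_prod_def dist_real_def stretch_def X_def Y_def)
  hence XY: "X\<^sup>2 + Y\<^sup>2 \<le> r\<^sup>2" by (rule sqrt_le_D)
  \<comment> \<open>The distance to a focus is affine in the coordinate along the major axis on the
    ellipse itself, and at most this value inside. The sign \<open>s\<close> selects the focus; the
    terms in \<open>Y\<close> cancel when both bounds are added.\<close>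
  have bound: "cmod (z - (m + \<i> * of_real (s * e))) \<le> r / b - s * c * Y / (a * b)"
    if s: "s\<^sup>2 = 1" for s
  proof (rule power2_le_imp_le)
    have "(cmod (z - (m + \<i> * of_real (s * e))))\<^sup>2 = (X / a)\<^sup>2 + (Y / b - s * e)\<^sup>2"
      by (simp add: cmod_power2 zm)
    also have "\<dots> = X\<^sup>2 / a\<^sup>2 + Y\<^sup>2 / b\<^sup>2 - 2 * s * r * c * Y / (a * b\<^sup>2) + s\<^sup>2 * c\<^sup>2 * r\<^sup>2 / (a * b)\<^sup>2"
      using ab by (simp add: e field_simps power2_eq_square)
    also have "(r / b - s * c * Y / (a * b))\<^sup>2 - \<dots> = (r\<^sup>2 - X\<^sup>2 - Y\<^sup>2) / a\<^sup>2"
      using ab unfolding s c power2_diff power_mult_distrib power_divide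
      by (simp add: field_simps power2_eq_square)
    finally have "(r / b - s * c * Y / (a * b))\<^sup>2 - (cmod (z - (m + \<i> * of_real (s * e))))\<^sup>2
      = (r\<^sup>2 - X\<^sup>2 - Y\<^sup>2) / a\<^sup>2" .
    moreover have "(r\<^sup>2 - X\<^sup>2 - Y\<^sup>2) / a\<^sup>2 \<ge> 0" using XY by simp
    ultimately show "(cmod (z - (m + \<i> * of_real (s * e))))\<^sup>2 \<le> (r / b - s * c * Y / (a * b))\<^sup>2"
      by linarith
    have "\<bar>s\<bar> = 1" using s by (simp add: abs_square_eq_1)
    have "Y\<^sup>2 \<le> r\<^sup>2" using XY zero_le_power2[of X] by linarith
    hence "\<bar>Y\<bar> \<le> r" using r abs_le_square_iff[of Y r] by simp
    moreover have "\<bar>c\<bar> \<le> a" using c ab abs_le_square_iff[of c a] by simp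
    ultimately have "\<bar>c\<bar> * \<bar>Y\<bar> \<le> a * r" using ab by (intro mult_mono) auto
    hence "s * c * Y \<le> a * r"
      using abs_ge_self[of "s * c * Y"] \<open>\<bar>s\<bar> = 1\<close> by (simp add: abs_mult)
    thus "0 \<le> r / b - s * c * Y / (a * b)" using ab by (simp add: field_simps)
  qed
  have "cmod (z - f) + cmod (z - g) \<le> 2 * r / b"
    using bound[of 1] bound[of "- 1"] by (simp add: f g)
  hence focal: "cmod (z - f) + cmod (z - g) \<le> cmod (1 - cnj f * g)" using fg by simp
  have "cmod z < 1"
  proof (rule ccontr)
    assume "\<not> cmod z < 1"
    hence z: "1 \<le> cmod z" by simp
    \<comment> \<open>Triangle inequality by way of \<open>z\<close>; \<open>cmod f < 1\<close> then
      makes the estimate strict.\<close>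
    have "1 - cnj f * g = (1 - cnj f * z) + cnj f * (z - g)" by (simp add: algebra_simps)
    hence "cmod (1 - cnj f * g) \<le> cmod (1 - cnj f * z) + cmod f * cmod (z - g)"
      by (metis norm_triangle_ineq norm_mult complex_mod_cnj)
    also have "\<dots> \<le> cmod (z - f) + cmod f * cmod (z - g)"
      using blaschke_le[OF \<open>cmod f < 1\<close> z] by simp
    also have "\<dots> < cmod (z - f) + cmod (z - g)"
    proof -
      have "z \<noteq> g" using z \<open>cmod g < 1\<close> by auto
      hence "cmod f * cmod (z - g) < 1 * cmod (z - g)"
        using \<open>cmod f < 1\<close> by (intro mult_strict_right_mono) auto
      thus ?thesis by simp
    qed
    finally show False using focal by simp
  qed
  thus "P \<in> ellipse_interior (0, 0) a b" unfolding Pz using ab by (simp add: stretch_in_interior_iff)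
qed

section \<open>Foci and the closure condition\<close>

text \<open>The dictionary between the foci and the parameters of \<open>chord_form\<close>. The
  fourth identity controls the position of the foci, the fifth ties the closure condition to the
  major axis.\<close>

lemma focal_identities:
  assumes ab: "0 < b" "b < a" and c: "c\<^sup>2 = a\<^sup>2 - b\<^sup>2" and e: "e = r * c / (a * b)"
    and f: "f = m + \<i> * of_real e" and g: "g = m - \<i> * of_real e"
  shows "e\<^sup>2 = r\<^sup>2 * (1 / b\<^sup>2 - 1 / a\<^sup>2)"
    and "f + g = 2 * m"
    and "f * g = m\<^sup>2 + of_real (r\<^sup>2 * (1 / b\<^sup>2 - 1 / a\<^sup>2))"
    and "(cmod f)\<^sup>2 + (cmod g)\<^sup>2 = 2 * (cmod m)\<^sup>2 + 2 * e\<^sup>2"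
    and "(cmod (1 - cnj f * g))\<^sup>2 = 1 + (cmod (f * g))\<^sup>2 - 2 * (cmod m)\<^sup>2 + 2 * e\<^sup>2"
proof -
  show e2: "e\<^sup>2 = r\<^sup>2 * (1 / b\<^sup>2 - 1 / a\<^sup>2)"
    using ab unfolding e power_divide power_mult_distrib c by (simp add: field_simps)
  show "f + g = 2 * m" by (simp add: f g)
  show "f * g = m\<^sup>2 + of_real (r\<^sup>2 * (1 / b\<^sup>2 - 1 / a\<^sup>2))"
    unfolding e2[symmetric] by (simp add: f g power2_eq_square algebra_simps)
  show "(cmod f)\<^sup>2 + (cmod g)\<^sup>2 = 2 * (cmod m)\<^sup>2 + 2 * e\<^sup>2"
    unfolding cmod_power2 by (simp add: f g power2_eq_square algebra_simps)
  show "(cmod (1 - cnj f * g))\<^sup>2 = 1 + (cmod (f * g))\<^sup>2 - 2 * (cmod m)\<^sup>2 + 2 * e\<^sup>2"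
    unfolding cmod_power2 by (simp add: f g power2_eq_square algebra_simps)
qed

text \<open>The left-hand side is Poncelet's closure condition (Cayley's criterion for triangles).\<close>

lemma closure_condition_factors:
  fixes a b c r :: real and m q :: complex
  assumes ab: "0 < b" "b < a" and c: "c\<^sup>2 = a\<^sup>2 - b\<^sup>2"
    and A: "A\<^sup>2 = b\<^sup>2 * (a^4 - c\<^sup>2 * (a * Re m)\<^sup>2)" and B: "B\<^sup>2 = a\<^sup>2 * (b^4 + c\<^sup>2 * (b * Im m)\<^sup>2)"
    and q: "q = m\<^sup>2 + of_real (r\<^sup>2 * (1 / b\<^sup>2 - 1 / a\<^sup>2))"
    and \<kappa>: "\<kappa> = (cmod m)\<^sup>2 - r\<^sup>2 * (1 / b\<^sup>2 + 1 / a\<^sup>2)"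
  shows "1 + (cmod q)\<^sup>2 + 2 * \<kappa> = 4 * (cmod m)\<^sup>2 \<longleftrightarrow>
    (c^4 * r\<^sup>2 - (A - B)\<^sup>2) * (c^4 * r\<^sup>2 - (A + B)\<^sup>2) = 0"
    and "A\<^sup>2 - B\<^sup>2 = c\<^sup>2 * (a * b)\<^sup>2 * (1 - (cmod m)\<^sup>2)"
proof -
  define u v k h where "u = (Re m)\<^sup>2" and "v = (Im m)\<^sup>2" and "k = 1 / b\<^sup>2 - 1 / a\<^sup>2"
    and "h = 1 / b\<^sup>2 + 1 / a\<^sup>2"
  have a2: "a\<^sup>2 = b\<^sup>2 + c\<^sup>2" using c by simp
  have c0: "c\<^sup>2 > 0" using c ab power_strict_mono[of b a 2] by simp
  have p4: "x ^ 4 = x\<^sup>2 * x\<^sup>2" for x :: real by (simp add: power4_eq_xxxx power2_eq_square)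
  have m2: "(cmod m)\<^sup>2 = u + v" by (simp add: cmod_power2 u_def v_def)
  have q2: "(cmod q)\<^sup>2 = (u + v)\<^sup>2 + 2 * (r\<^sup>2 * k) * (u - v) + (r\<^sup>2 * k)\<^sup>2"
    unfolding cmod_power2 q k_def[symmetric] u_def v_def
    by (simp add: power2_eq_square algebra_simps)
  have A': "A\<^sup>2 = a\<^sup>2 * b\<^sup>2 * (a\<^sup>2 - c\<^sup>2 * u)" and B': "B\<^sup>2 = a\<^sup>2 * b\<^sup>2 * (b\<^sup>2 + c\<^sup>2 * v)"
    unfolding A B p4 power_mult_distrib u_def v_def by (simp_all add: algebra_simps)
  show dif: "A\<^sup>2 - B\<^sup>2 = c\<^sup>2 * (a * b)\<^sup>2 * (1 - (cmod m)\<^sup>2)"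
    unfolding A' B' m2 power_mult_distrib a2 by (simp add: algebra_simps)
  \<comment> \<open>Multiplication by \<open>(a * b)\<^sup>2\<close> clears the denominators in
    \<open>k\<close> and \<open>h\<close>.\<close>
  have abk: "(a * b)\<^sup>2 * k = c\<^sup>2"
    using ab unfolding k_def c power_mult_distrib by (simp add: field_simps)
  have abh: "(a * b)\<^sup>2 * h = a\<^sup>2 + b\<^sup>2"
    using ab unfolding h_def power_mult_distrib by (simp add: field_simps)
  \<comment> \<open>Expanded, the product contains only even powers of \<open>A\<close> and
    \<open>B\<close>, so the square roots behind them disappear.\<close>
  have "(c^4 * r\<^sup>2 - (A - B)\<^sup>2) * (c^4 * r\<^sup>2 - (A + B)\<^sup>2)
      = (c^4 * r\<^sup>2)\<^sup>2 - 2 * (A\<^sup>2 + B\<^sup>2) * (c^4 * r\<^sup>2) + (A\<^sup>2 - B\<^sup>2)\<^sup>2"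
    by (simp add: power2_eq_square algebra_simps)
  also have "\<dots> = c^4 * ((c\<^sup>2 * r\<^sup>2)\<^sup>2 - 2 * (A\<^sup>2 + B\<^sup>2) * r\<^sup>2 + ((a * b)\<^sup>2)\<^sup>2 * (1 - (u + v))\<^sup>2)"
    unfolding dif m2 p4 power_mult_distrib by (simp add: power2_eq_square algebra_simps)
  also have "(c\<^sup>2 * r\<^sup>2)\<^sup>2 - 2 * (A\<^sup>2 + B\<^sup>2) * r\<^sup>2 + ((a * b)\<^sup>2)\<^sup>2 * (1 - (u + v))\<^sup>2
      = ((a * b)\<^sup>2)\<^sup>2 * (1 + (cmod q)\<^sup>2 + 2 * \<kappa> - 4 * (cmod m)\<^sup>2)"
  proof -
    have "((a * b)\<^sup>2)\<^sup>2 * (1 + (cmod q)\<^sup>2 + 2 * \<kappa> - 4 * (cmod m)\<^sup>2)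
      = ((a * b)\<^sup>2)\<^sup>2 * (1 - (u + v))\<^sup>2 + 2 * r\<^sup>2 * (a * b)\<^sup>2 * ((a * b)\<^sup>2 * k) * (u - v)
        + (r\<^sup>2)\<^sup>2 * ((a * b)\<^sup>2 * k)\<^sup>2 - 2 * r\<^sup>2 * (a * b)\<^sup>2 * ((a * b)\<^sup>2 * h)"
      unfolding q2 \<kappa> m2 h_def[symmetric] by (simp add: power2_eq_square algebra_simps)
    note scaled = this[unfolded abk abh]
    show ?thesis unfolding scaled unfolding A' B' power_mult_distrib by (simp add: power2_eq_square algebra_simps)
  qed
  finally have eq: "(c^4 * r\<^sup>2 - (A - B)\<^sup>2) * (c^4 * r\<^sup>2 - (A + B)\<^sup>2)
      = c^4 * (((a * b)\<^sup>2)\<^sup>2 * (1 + (cmod q)\<^sup>2 + 2 * \<kappa> - 4 * (cmod m)\<^sup>2))" .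
  show "1 + (cmod q)\<^sup>2 + 2 * \<kappa> = 4 * (cmod m)\<^sup>2 \<longleftrightarrow>
    (c^4 * r\<^sup>2 - (A - B)\<^sup>2) * (c^4 * r\<^sup>2 - (A + B)\<^sup>2) = 0"
  proof -
    have "a \<noteq> 0" "b \<noteq> 0" "c \<noteq> 0" using ab c0 by auto
    thus ?thesis unfolding eq by simp
  qed
qed

section \<open>The radius of the common incircle\<close>

text \<open>\<open>A\<close> and \<open>B\<close> are \<open>b\<close> and \<open>a\<close> times
  the square roots in the formula for the inradius, which reads \<open>(A - B) / c\<^sup>2\<close>.
  Fixing their squares and signs keeps the roots out of the algebra.\<close>

locale poncelet_data =
  fixes a b c A B :: real and m :: complex
  assumes ab: "0 < b" "b < a" and c: "c\<^sup>2 = a\<^sup>2 - b\<^sup>2" and m: "cmod m < 1"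
    and A: "A\<^sup>2 = b\<^sup>2 * (a^4 - c\<^sup>2 * (a * Re m)\<^sup>2)" and B: "B\<^sup>2 = a\<^sup>2 * (b^4 + c\<^sup>2 * (b * Im m)\<^sup>2)"
    and A_nonneg: "0 \<le> A" and B_nonneg: "0 \<le> B"
begin

text \<open>The value of \<open>q\<close> in \<open>chord_form\<close> for radius \<open>r\<close>,
  the product of the two foci; \<open>coef\<close> is likewise the value of
  \<open>\<kappa>\<close>.\<close>

definition quad :: "real \<Rightarrow> complex" where
  "quad r = m\<^sup>2 + of_real (r\<^sup>2 * (1 / b\<^sup>2 - 1 / a\<^sup>2))"

definition coef :: "real \<Rightarrow> real" where
  "coef r = (cmod m)\<^sup>2 - r\<^sup>2 * (1 / b\<^sup>2 + 1 / a\<^sup>2)"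

definition closure_condition :: "real \<Rightarrow> bool" where
  "closure_condition r \<longleftrightarrow> 1 + (cmod (quad r))\<^sup>2 + 2 * coef r = 4 * (cmod m)\<^sup>2"

definition focus :: "real \<Rightarrow> complex" where
  "focus r = m + \<i> * of_real (r * c / (a * b))"

definition focus' :: "real \<Rightarrow> complex" where
  "focus' r = m - \<i> * of_real (r * c / (a * b))"

abbreviation nested :: "real \<Rightarrow> bool" where
  "nested r \<equiv> cball (stretch a b m) r \<subseteq> ellipse_interior (0, 0) a b"

lemma c_pos: "0 < c\<^sup>2"
  using c ab power_strict_mono[of b a 2] by simp

lemma B_pos: "0 < B"
proof -
  have "0 < a\<^sup>2 * (b^4 + c\<^sup>2 * (b * Im m)\<^sup>2)"
    using ab by (intro mult_pos_pos add_pos_nonneg) simp_all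
  thus ?thesis using B B_nonneg by (cases "B = 0") auto
qed

lemma diff_squares: "(A - B) * (A + B) = c\<^sup>2 * (a * b)\<^sup>2 * (1 - (cmod m)\<^sup>2)"
  using closure_condition_factors(2)[OF ab c A B refl refl]
  by (simp add: power2_eq_square algebra_simps)

lemma B_less_A: "B < A"
proof -
  have "(cmod m)\<^sup>2 < 1" using m by (simp only: abs_square_less_1 abs_norm_cancel)
  hence "0 < (A - B) * (A + B)"
    unfolding diff_squares using c_pos ab by (intro mult_pos_pos) simp_all
  thus ?thesis using A_nonneg B_pos by (simp add: zero_less_mult_iff)
qed

lemma closure_condition_iff:
  "closure_condition r \<longleftrightarrow> (c^4 * r\<^sup>2 - (A - B)\<^sup>2) * (c^4 * r\<^sup>2 - (A + B)\<^sup>2) = 0"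
  unfolding closure_condition_def
  by (rule closure_condition_factors(1)[OF ab c A B quad_def coef_def])

lemmas focal = focal_identities[OF ab c refl focus_def focus'_def]

lemma focus_mult: "focus r * focus' r = quad r"
  unfolding focal(3) quad_def ..

lemma nested_foci:
  assumes "0 < r" "nested r"
  shows "cmod (focus r) < 1" "cmod (focus' r) < 1"
  using norm_focus_less_1[OF ab c assms, of "r * c / (a * b)"]
    norm_focus_less_1[OF ab c assms, of "- (r * c / (a * b))"]
  by (simp_all add: focus_def focus'_def)

text \<open>The closure condition reduces the square of the left side to \<open>4 r^2 / b^2\<close>.
  Thus the left side is the length of the major axis, which is the focal sum needed for
  nestedness.\<close>

lemma norm_1_minus_foci:
  assumes "closure_condition r" "0 < r"
  shows "cmod (1 - cnj (focus r) * focus' r) = 2 * r / b"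
proof -
  have "(cmod (1 - cnj (focus r) * focus' r))\<^sup>2 = (2 * r / b)\<^sup>2"
    using assms(1) unfolding focal(5) focus_mult focal(1) closure_condition_def coef_def
    by (simp add: power_mult_distrib power_divide algebra_simps)
  thus ?thesis using ab assms(2) by (simp add: power2_eq_iff_nonneg)
qed

lemma square_scaled_radius: "c^4 * r\<^sup>2 = (c\<^sup>2 * r)\<^sup>2"
  by (simp add: power2_eq_square power4_eq_xxxx)

text \<open>Nestedness picks the smaller root: both foci lie in the unit disc, so the square of \<open>c\<^sup>2 * r\<close> is
  below the product \<open>(A - B) * (A + B)\<close> of the two candidates.\<close>

lemma radius_unique:
  assumes "0 < r" "nested r" "closure_condition r"
  shows "r = (A - B) / c\<^sup>2"
proof -
  have "(cmod (focus r))\<^sup>2 < 1" "(cmod (focus' r))\<^sup>2 < 1"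
    using nested_foci[OF assms(1,2)] by (simp_all only: abs_square_less_1 abs_norm_cancel)
  hence "(r * c / (a * b))\<^sup>2 < 1 - (cmod m)\<^sup>2"
    using focal(4)[of r] by linarith
  hence "(a * b)\<^sup>2 * (r * c / (a * b))\<^sup>2 < (a * b)\<^sup>2 * (1 - (cmod m)\<^sup>2)"
    using ab by (intro mult_strict_left_mono) simp_all
  moreover have "(a * b)\<^sup>2 * (r * c / (a * b))\<^sup>2 = r\<^sup>2 * c\<^sup>2"
    using ab by (simp add: power_divide power_mult_distrib)
  ultimately have "c\<^sup>2 * (r\<^sup>2 * c\<^sup>2) < c\<^sup>2 * ((a * b)\<^sup>2 * (1 - (cmod m)\<^sup>2))"
    using c_pos by (intro mult_strict_left_mono) simp_all
  hence lt: "(c\<^sup>2 * r)\<^sup>2 < (A - B) * (A + B)"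
    unfolding diff_squares by (simp add: power2_eq_square algebra_simps)
  have "(A - B) * (A + B) \<le> (A + B)\<^sup>2"
    using A_nonneg B_pos by (simp add: power2_eq_square mult_right_mono)
  with lt have "(c\<^sup>2 * r)\<^sup>2 \<noteq> (A + B)\<^sup>2" by simp
  hence "(c\<^sup>2 * r)\<^sup>2 = (A - B)\<^sup>2"
    using assms(3) unfolding closure_condition_iff square_scaled_radius by simp
  hence "c\<^sup>2 * r = A - B"
    using B_less_A c_pos assms(1) by (subst (asm) power2_eq_iff_nonneg) simp_all
  thus ?thesis using c_pos by (simp add: field_simps)
qed

text \<open>The smaller candidate satisfies \<open>(A - B)^2 < (A - B) (A + B)\<close>, which keeps
  the sum of the squared moduli of the foci below 2. The closure condition makes
  \<open>(1 - |f|^2) (1 - |g|^2)\<close> positive. Together they put both foci in the disc, and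
  \<open>cball_nested\<close> applies.\<close>

lemma radius_exists:
  fixes r defines "r \<equiv> (A - B) / c\<^sup>2"
  shows "0 < r" "closure_condition r" "nested r"
proof -
  have cr: "c\<^sup>2 * r = A - B" using c_pos by (simp add: r_def)
  show r: "0 < r" using B_less_A c_pos by (simp add: r_def)
  show cc: "closure_condition r" unfolding closure_condition_iff square_scaled_radius cr by simp
  have "(A - B) * (A - B) < (A - B) * (A + B)"
    using B_less_A B_pos by (intro mult_strict_left_mono) simp_all
  hence "(c\<^sup>2 * r)\<^sup>2 < c\<^sup>2 * (a * b)\<^sup>2 * (1 - (cmod m)\<^sup>2)"
    unfolding cr diff_squares by (simp add: power2_eq_square)
  hence "c\<^sup>2 * (c\<^sup>2 * r\<^sup>2) < c\<^sup>2 * ((a * b)\<^sup>2 * (1 - (cmod m)\<^sup>2))"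
    by (simp add: power2_eq_square algebra_simps)
  hence "c\<^sup>2 * r\<^sup>2 < (a * b)\<^sup>2 * (1 - (cmod m)\<^sup>2)"
    by (rule mult_left_less_imp_less) simp
  moreover have "c\<^sup>2 * r\<^sup>2 = (a * b)\<^sup>2 * (r * c / (a * b))\<^sup>2"
    using ab by (simp add: power_divide power_mult_distrib)
  ultimately have "(a * b)\<^sup>2 * (r * c / (a * b))\<^sup>2 < (a * b)\<^sup>2 * (1 - (cmod m)\<^sup>2)" by simp
  hence "(r * c / (a * b))\<^sup>2 < 1 - (cmod m)\<^sup>2"
    using ab by (subst (asm) mult_less_cancel_left_pos) simp_all
  hence sum: "(cmod (focus r))\<^sup>2 + (cmod (focus' r))\<^sup>2 < 2" unfolding focal(4) by simp
  \<comment> \<open>This product turns out to be the square of the minor axis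
    \<open>2 * r / a\<close>.\<close>
  have "(1 - (cmod (focus r))\<^sup>2) * (1 - (cmod (focus' r))\<^sup>2)
      = 1 + (cmod (quad r))\<^sup>2 - ((cmod (focus r))\<^sup>2 + (cmod (focus' r))\<^sup>2)"
    unfolding focus_mult[symmetric] norm_mult power_mult_distrib by (simp add: algebra_simps)
  also have "\<dots> = 4 * r\<^sup>2 / a\<^sup>2"
    using cc unfolding focal(4) focal(1) closure_condition_def coef_def
    by (simp add: algebra_simps)
  also have "\<dots> > 0" using r ab by simp
  finally have "0 < (1 - (cmod (focus r))\<^sup>2) * (1 - (cmod (focus' r))\<^sup>2)" .
  with sum have "(cmod (focus r))\<^sup>2 < 1 \<and> (cmod (focus' r))\<^sup>2 < 1"
    unfolding zero_less_mult_iff by linarith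
  hence foci: "cmod (focus r) < 1" "cmod (focus' r) < 1"
    by (simp_all only: abs_square_less_1 abs_norm_cancel)
  show "nested r"
    by (rule cball_nested[OF ab c r refl focus_def focus'_def foci norm_1_minus_foci[OF cc r]])
qed

definition r\<^sub>0 :: real where "r\<^sub>0 = (A - B) / c\<^sup>2"

lemmas r0 = radius_exists[folded r\<^sub>0_def]

section \<open>The locus as the image of a circle\<close>

lemma tangent_iff:
  assumes "0 < r" "cmod z = 1" "cmod w = 1" "z \<noteq> w"
  shows "line_tangent_to_circle (stretch a b z) (stretch a b w) (stretch a b m) r
    \<longleftrightarrow> chord_form m (quad r) (coef r) z w = 0"
  using ab by (intro tangent_stretch_iff_chord_form assms quad_def coef_def) simp_all

lemma ellipse_iff: "P \<in> ellipse (0, 0) a b \<longleftrightarrow> (\<exists>z. cmod z = 1 \<and> P = stretch a b z)"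
  using ellipse_eq_stretch_sphere[of a b 1 0] ab by (auto simp: stretch_def[of a b 0])

lemma barycenter_stretch:
  "barycenter (stretch a b z1) (stretch a b z2) (stretch a b z3) = stretch a b ((z1 + z2 + z3) / 3)"
  by (simp add: barycenter_def stretch_def algebra_simps)

text \<open>The radius that comes with a triangle is arbitrary at first; the triangle forces the
  closure condition, and nestedness then leaves only \<open>r\<^sub>0\<close>. Hence the vertex sum
  differs from \<open>2 * m\<close> by a number of fixed modulus.\<close>

lemma barycenter_locus_subset:
  "barycenter_locus a b (stretch a b m) \<subseteq> stretch a b ` sphere (2 * m / 3) (cmod (quad r\<^sub>0) / 3)"
proof
  fix X assume "X \<in> barycenter_locus a b (stretch a b m)"
  then obtain P Q R r where X: "X = barycenter P Q R" and nc: "\<not> collinear {P, Q, R}"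
    and on: "{P, Q, R} \<subseteq> ellipse (0, 0) a b" and r: "0 < r" "nested r"
    and tangent: "line_tangent_to_circle P Q (stretch a b m) r"
      "line_tangent_to_circle Q R (stretch a b m) r" "line_tangent_to_circle R P (stretch a b m) r"
    unfolding barycenter_locus_def poncelet_family_def by blast
  obtain z1 z2 z3 where PQR: "P = stretch a b z1" "Q = stretch a b z2" "R = stretch a b z3"
    and unit: "cmod z1 = 1" "cmod z2 = 1" "cmod z3 = 1"
    using on by (auto simp: ellipse_iff)
  have "P \<noteq> Q" "P \<noteq> R" "Q \<noteq> R" using nc collinear_2 by (auto simp: insert_commute)
  hence distinct: "z1 \<noteq> z2" "z1 \<noteq> z3" "z2 \<noteq> z3" unfolding PQR by auto
  have chords: "chord_form m (quad r) (coef r) z1 z2 = 0" "chord_form m (quad r) (coef r) z2 z3 = 0"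
    "chord_form m (quad r) (coef r) z3 z1 = 0"
    using tangent unfolding PQR
    by (simp_all only: tangent_iff[OF r(1) unit(1,2) distinct(1)] tangent_iff[OF r(1) unit(2,3) distinct(3)]
      tangent_iff[OF r(1) unit(3,1) distinct(2)[symmetric]])
  have sum: "z1 + z2 + z3 = 2 * m + cnj (quad r) * (z1 * z2 * z3)"
    by (rule chord_form_triple(1)[OF unit distinct chords])
  have "closure_condition r"
    unfolding closure_condition_def by (rule chord_form_triple(2)[OF unit distinct chords])
  hence "r = r\<^sub>0" unfolding r\<^sub>0_def by (intro radius_unique r)
  have shift: "(z1 + z2 + z3) / 3 - 2 * m / 3 = cnj (quad r\<^sub>0) * (z1 * z2 * z3) / 3"
    unfolding sum \<open>r = r\<^sub>0\<close> by (simp add: field_simps)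
  have "cmod ((z1 + z2 + z3) / 3 - 2 * m / 3) = cmod (quad r\<^sub>0) / 3"
    unfolding shift by (simp add: norm_mult norm_divide unit)
  hence "(z1 + z2 + z3) / 3 \<in> sphere (2 * m / 3) (cmod (quad r\<^sub>0) / 3)"
    by (simp add: dist_norm norm_minus_commute)
  thus "X \<in> stretch a b ` sphere (2 * m / 3) (cmod (quad r\<^sub>0) / 3)"
    unfolding X PQR barycenter_stretch by (rule imageI)
qed

text \<open>The vertices are the solutions of the Blaschke equation for \<open>\<mu>\<close>. Its
  roots have unit modulus, their symmetric functions give the tangencies, and the form on the
  diagonal gives distinctness.\<close>

lemma poncelet_triple_exists:
  assumes l: "cmod \<mu> = 1"
  shows "stretch a b ((2 * m + cnj (quad r\<^sub>0) * \<mu>) / 3) \<in> barycenter_locus a b (stretch a b m)"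
proof -
  define f g q \<kappa> where "f = focus r\<^sub>0" and "g = focus' r\<^sub>0" and "q = quad r\<^sub>0" and "\<kappa> = coef r\<^sub>0"
  have fg: "cmod f < 1" "cmod g < 1" using nested_foci[OF r0(1,3)] by (simp_all add: f_def g_def)
  have q: "q = f * g" by (simp add: q_def f_def g_def focus_mult)
  have m2: "2 * m = f + g" by (simp add: f_def g_def focal(2))
  have cm: "2 * cnj m = cnj f + cnj g" using arg_cong[OF m2, of cnj] by simp
  have cayley: "1 + (cmod q)\<^sup>2 + 2 * \<kappa> = 4 * (cmod m)\<^sup>2"
    using r0(2) by (simp add: closure_condition_def q_def \<kappa>_def)
  \<comment> \<open>The prescribed values are, up to sign, the coefficients of the Blaschke equation
    with denominators cleared.\<close>
  obtain z1 z2 z3 where e1: "z1 + z2 + z3 = 2 * m + cnj q * \<mu>"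
    and e2: "z1 * z2 + z2 * z3 + z3 * z1 = q + 2 * cnj m * \<mu>" and e3: "z1 * z2 * z3 = \<mu>"
    by (rule monic_cubic_factors)
  have unit_root: "cmod z = 1" if "z = z1 \<or> z = z2 \<or> z = z3" for z
  proof (rule blaschke_root_unit[OF fg l])
    have "0 = (z - z1) * (z - z2) * (z - z3)" using that by auto
    also have "\<dots> = z ^ 3 - (z1 + z2 + z3) * z\<^sup>2 + (z1 * z2 + z2 * z3 + z3 * z1) * z - z1 * z2 * z3"
      by (simp add: power2_eq_square power3_eq_cube algebra_simps)
    also have "\<dots> = z * (z - f) * (z - g) - \<mu> * (1 - cnj f * z) * (1 - cnj g * z)"
      unfolding e1 e2 e3 m2 cm q by (simp add: power2_eq_square power3_eq_cube algebra_simps)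
    finally show "z * (z - f) * (z - g) = \<mu> * (1 - cnj f * z) * (1 - cnj g * z)" by simp
  qed
  hence unit: "cmod z1 = 1" "cmod z2 = 1" "cmod z3 = 1" by simp_all
  hence nz: "z1 \<noteq> 0" "z2 \<noteq> 0" "z3 \<noteq> 0" by auto
  have chord: "chord_form m q \<kappa> z1 z2 = 0"
    by (rule chord_form_eq_0_if_symmetric[OF nz(3) _ _ cayley]) (simp_all add: e1 e2 e3)
  have chord2: "chord_form m q \<kappa> z2 z3 = 0"
    by (rule chord_form_eq_0_if_symmetric[OF nz(1) _ _ cayley])
       (use e1 e2 e3 in \<open>simp_all add: algebra_simps\<close>)
  have chord3: "chord_form m q \<kappa> z3 z1 = 0"
    by (rule chord_form_eq_0_if_symmetric[OF nz(2) _ _ cayley])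
       (use e1 e2 e3 in \<open>simp_all add: algebra_simps\<close>)
  have diag: "chord_form m q \<kappa> z z \<noteq> 0" if "cmod z = 1" for z
    by (rule chord_form_diag_nonzero[OF fg that m2 q cayley])
  \<comment> \<open>If two vertices agreed, a chord equation would hold on the diagonal.\<close>
  have distinct: "z1 \<noteq> z2" "z1 \<noteq> z3" "z2 \<noteq> z3"
    using diag[OF unit(1)] diag[OF unit(2)] diag[OF unit(3)] chord chord2 chord3 by auto
  have "(stretch a b z1, stretch a b z2, stretch a b z3) \<in> poncelet_family a b (stretch a b m)"
  proof -
    have "\<not> collinear {stretch a b z1, stretch a b z2, stretch a b z3}"
      using ab by (intro not_collinear_stretch unit distinct) simp_all
    moreover have "{stretch a b z1, stretch a b z2, stretch a b z3} \<subseteq> ellipse (0, 0) a b"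
      using unit by (auto simp: ellipse_iff)
    moreover have "line_tangent_to_circle (stretch a b z1) (stretch a b z2) (stretch a b m) r\<^sub>0"
      using chord unfolding tangent_iff[OF r0(1) unit(1,2) distinct(1)] q_def \<kappa>_def .
    moreover have "line_tangent_to_circle (stretch a b z2) (stretch a b z3) (stretch a b m) r\<^sub>0"
      using chord2 unfolding tangent_iff[OF r0(1) unit(2,3) distinct(3)] q_def \<kappa>_def .
    moreover have "line_tangent_to_circle (stretch a b z3) (stretch a b z1) (stretch a b m) r\<^sub>0"
      using chord3 unfolding tangent_iff[OF r0(1) unit(3,1) distinct(2)[symmetric]] q_def \<kappa>_def .
    ultimately show ?thesis unfolding poncelet_family_def using r0(1,3) by blast
  qed
  hence "barycenter (stretch a b z1) (stretch a b z2) (stretch a b z3) \<in> barycenter_locus a b (stretch a b m)"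
    unfolding barycenter_locus_def by blast
  thus ?thesis unfolding barycenter_stretch e1 q_def .
qed

lemma barycenter_locus_eq:
  "barycenter_locus a b (stretch a b m) = stretch a b ` sphere (2 * m / 3) (cmod (quad r\<^sub>0) / 3)"
proof (rule subset_antisym[OF barycenter_locus_subset], rule image_subsetI)
  fix z assume "z \<in> sphere (2 * m / 3) (cmod (quad r\<^sub>0) / 3)"
  hence z: "cmod (z - 2 * m / 3) = cmod (quad r\<^sub>0) / 3"
    by (simp add: dist_norm norm_minus_commute)
  obtain \<mu> where l: "cmod \<mu> = 1" and \<mu>: "z = (2 * m + cnj (quad r\<^sub>0) * \<mu>) / 3"
  proof (cases "quad r\<^sub>0 = 0")
    \<comment> \<open>The circle is a single point here and any unit number serves as
      \<open>\<mu>\<close>; 1 is taken.\<close>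
    case True
    hence "z = 2 * m / 3" using z by simp
    thus ?thesis using True that[of 1] by simp
  next
    case False
    define w where "w = z - 2 * m / 3"
    define \<mu> where "\<mu> = 3 * w / cnj (quad r\<^sub>0)"
    have "cmod \<mu> = 1" using False z unfolding w_def[symmetric] by (simp add: \<mu>_def norm_divide norm_mult)
    moreover have "z = (2 * m + cnj (quad r\<^sub>0) * \<mu>) / 3" using False by (simp add: \<mu>_def w_def field_simps)
    ultimately show ?thesis by (rule that)
  qed
  show "stretch a b z \<in> barycenter_locus a b (stretch a b m)"
    unfolding \<mu> by (rule poncelet_triple_exists[OF l])
qed

text \<open>The closure condition solved for the modulus of \<open>quad r\<^sub>0\<close>: the
  source of the formula for the semi-axes.\<close>

lemma norm_quad:
  "(cmod (quad r\<^sub>0))\<^sup>2 = 2 * (cmod m)\<^sup>2 - 1 + 2 * (1 / b\<^sup>2 + 1 / a\<^sup>2) * (A - B)\<^sup>2 / c^4"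
  using r0(2) unfolding closure_condition_def coef_def
  by (simp add: r\<^sub>0_def power_divide add_divide_distrib algebra_simps flip: power_mult)

end

section \<open>Homothety\<close>

text \<open>The ratio is \<open>- \<rho>\<close>, admissible because the unit circle is symmetric
  about 0. It always has a centre, whereas ratio \<open>\<rho>\<close> would call for a translation
  when \<open>\<rho> = 1\<close>.\<close>

lemma homothetic_stretch_sphere:
  assumes "0 < \<rho>"
  shows "homothetic (stretch a b ` sphere m \<rho>) (stretch a b ` sphere 0 1)"
proof -
  \<comment> \<open>The image of the fixed point of the map taking \<open>w\<close> to
    \<open>m - \<rho> w\<close>.\<close>
  define Q where "Q = stretch a b (m / of_real (1 + \<rho>))"
  have Q: "(1 + \<rho>) *\<^sub>R Q = stretch a b m"
    using assms by (simp add: Q_def stretch_def)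
  have hom: "homothety Q (- \<rho>) (stretch a b w) = stretch a b (m - of_real \<rho> * w)" for w
  proof -
    have "homothety Q (- \<rho>) (stretch a b w) = (1 + \<rho>) *\<^sub>R Q - \<rho> *\<^sub>R stretch a b w"
      by (simp add: homothety_def algebra_simps)
    also have "\<dots> = stretch a b (m - of_real \<rho> * w)"
      unfolding Q by (simp add: stretch_def algebra_simps)
    finally show ?thesis .
  qed
  have "sphere m \<rho> = (\<lambda>w. m - of_real \<rho> * w) ` sphere 0 1"
  proof (intro subset_antisym subsetI)
    fix z assume "z \<in> sphere m \<rho>"
    hence z: "cmod (m - z) = \<rho>" by (simp add: dist_norm)
    have "z = m - of_real \<rho> * ((m - z) / of_real \<rho>)" using assms by simp
    moreover have "(m - z) / of_real \<rho> \<in> sphere 0 1" using assms z by (simp add: norm_divide)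
    ultimately show "z \<in> (\<lambda>w. m - of_real \<rho> * w) ` sphere 0 1" by (rule image_eqI)
  next
    fix z assume "z \<in> (\<lambda>w. m - of_real \<rho> * w) ` sphere 0 1"
    thus "z \<in> sphere m \<rho>" using assms by (auto simp: dist_norm norm_mult)
  qed
  hence "stretch a b ` sphere m \<rho> = homothety Q (- \<rho>) ` (stretch a b ` sphere 0 1)"
    by (simp add: image_image hom)
  thus ?thesis unfolding homothetic_def using assms by (intro exI[of _ Q] exI[of _ "- \<rho>"]) simp
qed

section \<open>Centre and semi-axes in Cartesian coordinates\<close>

theorem proposition3:
  fixes a b c x\<^sub>c y\<^sub>c \<delta> :: real and C C\<^sub>2 :: "real \<times> real"
  assumes "0 < b" and "b < a" and "c\<^sup>2 = a\<^sup>2 - b\<^sup>2"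
    and "C = (x\<^sub>c, y\<^sub>c)" and "C \<in> ellipse_interior (0, 0) a b"
    and "\<delta> = sqrt ((b^4 + c\<^sup>2 * y\<^sub>c\<^sup>2) * (a^4 - c\<^sup>2 * x\<^sub>c\<^sup>2))"
    and "C\<^sub>2 = (2 / 3) *\<^sub>R (x\<^sub>c, y\<^sub>c)"
  shows "\<exists>a\<^sub>2 b\<^sub>2. 0 \<le> a\<^sub>2 \<and> 0 \<le> b\<^sub>2
    \<and> a\<^sub>2\<^sup>2 = (- 4 * a * b * (a\<^sup>2 + b\<^sup>2) * \<delta> - 4 * b^4 * c\<^sup>2 * x\<^sub>c\<^sup>2 + 4 * a^4 * c\<^sup>2 * y\<^sub>c\<^sup>2
               + a\<^sup>2 * b\<^sup>2 * (a^4 + 6 * a\<^sup>2 * b\<^sup>2 + b^4)) / (9 * b\<^sup>2 * c^4)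
    \<and> b\<^sub>2\<^sup>2 = b\<^sup>2 / a\<^sup>2 * a\<^sub>2\<^sup>2
    \<and> barycenter_locus a b C = ellipse C\<^sub>2 a\<^sub>2 b\<^sub>2
    \<and> (a\<^sub>2 > 0 \<longrightarrow> homothetic (barycenter_locus a b C) (ellipse (0, 0) a b))
    \<and> collinear {(0, 0), C, C\<^sub>2}"
proof -
  note ab = assms(1,2) and c = assms(3)
  have a: "0 < a" using ab by simp
  define m where "m = Complex (x\<^sub>c / a) (y\<^sub>c / b)"
  have C: "C = stretch a b m" using ab assms(4) by (simp add: m_def stretch_def)
  have xy: "a * Re m = x\<^sub>c" "b * Im m = y\<^sub>c" using ab by (simp_all add: m_def)
  have m: "cmod m < 1" using assms(5) stretch_in_interior_iff[OF a ab(1)] by (simp add: C)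
  \<comment> \<open>The radicand of \<open>A\<close> has to be nonnegative for \<open>A\<close> to
    have the prescribed square.\<close>
  have D1: "0 \<le> a^4 - c\<^sup>2 * x\<^sub>c\<^sup>2"
  proof -
    have "\<bar>Re m\<bar> \<le> 1" using m abs_Re_le_cmod[of m] by linarith
    hence "(Re m)\<^sup>2 \<le> 1" by (simp add: abs_square_le_1)
    hence "a\<^sup>2 * (Re m)\<^sup>2 \<le> a\<^sup>2" by (simp add: mult_left_le)
    hence "x\<^sub>c\<^sup>2 \<le> a\<^sup>2" unfolding xy(1)[symmetric] by (simp add: power_mult_distrib)
    moreover have "c\<^sup>2 \<le> a\<^sup>2" unfolding c by simp
    ultimately have "c\<^sup>2 * x\<^sub>c\<^sup>2 \<le> a\<^sup>2 * a\<^sup>2" by (intro mult_mono) simp_all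
    thus ?thesis by (simp add: power4_eq_xxxx power2_eq_square)
  qed
  have D2: "0 \<le> b^4 + c\<^sup>2 * y\<^sub>c\<^sup>2" by simp
  define A B where "A = b * sqrt (a^4 - c\<^sup>2 * x\<^sub>c\<^sup>2)" and "B = a * sqrt (b^4 + c\<^sup>2 * y\<^sub>c\<^sup>2)"
  have A2: "A\<^sup>2 = b\<^sup>2 * (a^4 - c\<^sup>2 * x\<^sub>c\<^sup>2)" and B2: "B\<^sup>2 = a\<^sup>2 * (b^4 + c\<^sup>2 * y\<^sub>c\<^sup>2)"
    using D1 D2 by (simp_all only: A_def B_def power_mult_distrib real_sqrt_pow2)
  \<comment> \<open>The mixed term of \<open>(A - B)\<^sup>2\<close> is where
    \<open>\<delta>\<close> enters the formula.\<close>
  have AB: "A * B = a * b * \<delta>"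
    by (simp add: A_def B_def assms(6) real_sqrt_mult)
  interpret poncelet_data a b c A B m
  proof unfold_locales
    show "A\<^sup>2 = b\<^sup>2 * (a^4 - c\<^sup>2 * (a * Re m)\<^sup>2)" "B\<^sup>2 = a\<^sup>2 * (b^4 + c\<^sup>2 * (b * Im m)\<^sup>2)"
      unfolding xy by (fact A2 B2)+
    show "0 \<le> A" "0 \<le> B" using ab a D1 D2 by (simp_all add: A_def B_def)
  qed (use ab c m in simp_all)
  define \<rho> where "\<rho> = cmod (quad r\<^sub>0) / 3"
  have \<rho>: "0 \<le> \<rho>" by (simp add: \<rho>_def)
  have C2: "C\<^sub>2 = stretch a b (2 * m / 3)"
    unfolding assms(7) xy[symmetric] by (simp add: stretch_def)
  have locus: "barycenter_locus a b C = stretch a b ` sphere (2 * m / 3) \<rho>"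
    unfolding C \<rho>_def by (rule barycenter_locus_eq)
  have E: "ellipse (0, 0) a b = stretch a b ` sphere 0 1"
    using ellipse_eq_stretch_sphere[OF a ab(1), of 1 0] by (simp add: stretch_def)
  have c4: "c^4 = (c\<^sup>2)\<^sup>2" by simp
  have "c \<noteq> 0" using c_pos by auto
  have size: "9 * b\<^sup>2 * c^4 * (a * \<rho>)\<^sup>2 = - 4 * a * b * (a\<^sup>2 + b\<^sup>2) * \<delta> - 4 * b^4 * c\<^sup>2 * x\<^sub>c\<^sup>2
      + 4 * a^4 * c\<^sup>2 * y\<^sub>c\<^sup>2 + a\<^sup>2 * b\<^sup>2 * (a^4 + 6 * a\<^sup>2 * b\<^sup>2 + b^4)"
  proof -
    have "9 * b\<^sup>2 * c^4 * (a * \<rho>)\<^sup>2 = a\<^sup>2 * b\<^sup>2 * c^4 * (cmod (quad r\<^sub>0))\<^sup>2"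
      by (simp add: \<rho>_def power_mult_distrib power_divide)
    also have "\<dots> = c^4 * (2 * (a\<^sup>2 * b\<^sup>2 * (cmod m)\<^sup>2) - a\<^sup>2 * b\<^sup>2) + 2 * (a\<^sup>2 + b\<^sup>2) * (A - B)\<^sup>2"
      unfolding norm_quad using ab \<open>c \<noteq> 0\<close> by (simp add: field_simps)
    also have "a\<^sup>2 * b\<^sup>2 * (cmod m)\<^sup>2 = b\<^sup>2 * x\<^sub>c\<^sup>2 + a\<^sup>2 * y\<^sub>c\<^sup>2"
      unfolding cmod_power2 xy[symmetric] by (simp add: power_mult_distrib algebra_simps)
    also have "(A - B)\<^sup>2 = b\<^sup>2 * (a^4 - c\<^sup>2 * x\<^sub>c\<^sup>2) + a\<^sup>2 * (b^4 + c\<^sup>2 * y\<^sub>c\<^sup>2) - 2 * (a * b * \<delta>)"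
      unfolding power2_diff A2 B2 AB[symmetric] by simp
    finally have expanded: "9 * b\<^sup>2 * c^4 * (a * \<rho>)\<^sup>2
      = c^4 * (2 * (b\<^sup>2 * x\<^sub>c\<^sup>2 + a\<^sup>2 * y\<^sub>c\<^sup>2) - a\<^sup>2 * b\<^sup>2)
        + 2 * (a\<^sup>2 + b\<^sup>2) * (b\<^sup>2 * (a^4 - c\<^sup>2 * x\<^sub>c\<^sup>2) + a\<^sup>2 * (b^4 + c\<^sup>2 * y\<^sub>c\<^sup>2) - 2 * (a * b * \<delta>))" .
    \<comment> \<open>The two sides agree only after \<open>c\<^sup>2\<close> is replaced by
      \<open>a\<^sup>2 - b\<^sup>2\<close>.\<close>
    show ?thesis
      unfolding expanded unfolding c4 c
      by (simp add: power2_eq_square power4_eq_xxxx algebra_simps)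
  qed
  show ?thesis
  \<comment> \<open>The semi-axes of the image of a circle of radius \<open>\<rho>\<close> under
    \<open>stretch\<close>.\<close>
  proof (rule exI[of _ "a * \<rho>"], rule exI[of _ "b * \<rho>"], intro conjI impI)
    show "0 \<le> a * \<rho>" "0 \<le> b * \<rho>" using a ab \<rho> by simp_all
    show "(a * \<rho>)\<^sup>2 = (- 4 * a * b * (a\<^sup>2 + b\<^sup>2) * \<delta> - 4 * b^4 * c\<^sup>2 * x\<^sub>c\<^sup>2 + 4 * a^4 * c\<^sup>2 * y\<^sub>c\<^sup>2
      + a\<^sup>2 * b\<^sup>2 * (a^4 + 6 * a\<^sup>2 * b\<^sup>2 + b^4)) / (9 * b\<^sup>2 * c^4)"
      unfolding size[symmetric] using ab \<open>c \<noteq> 0\<close> by simp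
    show "(b * \<rho>)\<^sup>2 = b\<^sup>2 / a\<^sup>2 * (a * \<rho>)\<^sup>2" using a by (simp add: power_mult_distrib)
    show "barycenter_locus a b C = ellipse C\<^sub>2 (a * \<rho>) (b * \<rho>)"
      unfolding locus C2 by (rule ellipse_eq_stretch_sphere[OF a ab(1) \<rho>, symmetric])
    show "homothetic (barycenter_locus a b C) (ellipse (0, 0) a b)" if "0 < a * \<rho>"
      unfolding locus E using that a by (intro homothetic_stretch_sphere) (simp add: zero_less_mult_iff)
    have "collinear {0, C, (2 / 3) *\<^sub>R C}" unfolding collinear_lemma by blast
    thus "collinear {(0, 0), C, C\<^sub>2}" unfolding assms(4,7) zero_prod_def .
  qed
qed

end
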